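(* Let $P(T) \in \mathbb{Z}[T]$ be a polynomial that is not equal to $\pm T^M$ for any $M \in \mathbb{N}\cup\{0\}$. For $N \in \mathbb{N}$ set $$Q_N(T) = \prod_{\substack{d \mid N\\ P(\zeta_d)^N = 1}}\Psi_d(T),$$ where $\zeta_d \in \mathbb{C}$ denotes a primitive $d$-th root of unity and $\Psi_d$ denotes the $d$-th cyclotomic polynomial. Then there exists a constant $c > 0$ such that $$\log \left|\mathbb{Z}[T,Q_N(T)^{-1}]/(T^N-1,P(T)^N-1)\right| \leq cN^2$$ for all $N \in \mathbb{N}$.
   Context: Here $\mathbb{N}=\{1,2,\dots\}$, $|R|$ denotes the cardinality of a ring $R$, and $(a,b)$ denotes the ideal generated by $a$ and $b$. The constant $c$ may depend on $P$ but not on $N$. *)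

theory Defs
  imports
    Complex_Main
    "HOL-Computational_Algebra.Computational_Algebra"
    "HOL-Algebra.QuotRing"
begin

section \<open>Cyclotomic polynomials\<close>

definition primitive_root_of_unity :: "nat \<Rightarrow> complex \<Rightarrow> bool" where
  "primitive_root_of_unity d z \<longleftrightarrow> d > 0 \<and> z ^ d = 1 \<and> (\<forall>k. 0 < k \<and> k < d \<longrightarrow> z ^ k \<noteq> 1)"

definition complex_cyclotomic :: "nat \<Rightarrow> complex poly" where
  "complex_cyclotomic d = (\<Prod>z | primitive_root_of_unity d z. [:- z, 1:])"

text \<open>
  The polynomial \<open>complex_cyclotomic d\<close> has integer coefficients, and \<open>cyclotomic d\<close> is the same
  polynomial seen in \<open>int poly\<close>. The definite description is justified by the lemma
  \<open>of_int_cyclotomic\<close> below.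
\<close>

definition cyclotomic :: "nat \<Rightarrow> int poly" where
  "cyclotomic d = (THE p. map_poly of_int p = complex_cyclotomic d)"

lemma of_int_poly_mult:
  "map_poly of_int (p * q) = (map_poly of_int p * map_poly of_int q :: complex poly)"
  by (intro poly_eqI) (simp add: coeff_map_poly coeff_mult)

lemma of_int_poly_add:
  "map_poly of_int (p + q) = (map_poly of_int p + map_poly of_int q :: complex poly)"
  by (intro poly_eqI) (simp add: coeff_map_poly)

lemma of_int_poly_diff:
  "map_poly of_int (p - q) = (map_poly of_int p - map_poly of_int q :: complex poly)"
  by (intro poly_eqI) (simp add: coeff_map_poly)

lemma of_int_poly_monom:
  "map_poly of_int (Polynomial.monom a n) = (Polynomial.monom (of_int a) n :: complex poly)"
  by (intro poly_eqI) (simp add: coeff_map_poly)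

lemma of_int_poly_one: "map_poly of_int 1 = (1 :: complex poly)"
  by (intro poly_eqI) (simp add: coeff_map_poly)

lemma of_int_poly_inject:
  "map_poly of_int p = (map_poly of_int q :: complex poly) \<Longrightarrow> p = q"
  by (metis (no_types, lifting) coeff_map_poly of_int_0 of_int_eq_iff poly_eqI)

lemma of_int_poly_degree: "Polynomial.degree (map_poly of_int p :: complex poly) = Polynomial.degree p"
  by (rule degree_map_poly) auto

lemma of_int_poly_prod:
  "finite A \<Longrightarrow> map_poly of_int (prod f A) = (\<Prod>x\<in>A. map_poly of_int (f x) :: complex poly)"
  by (induction A rule: finite_induct) (simp_all add: of_int_poly_mult of_int_poly_one)

lemma finite_primitive_roots: "finite {z. primitive_root_of_unity d z}"
proof (cases "d = 0")
  case False
  then have "finite {z::complex. z ^ d = 1}"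
    by (intro finite_roots_unity) auto
  then show ?thesis
    by (rule rev_finite_subset) (auto simp: primitive_root_of_unity_def)
qed (simp add: primitive_root_of_unity_def)

lemma primitive_root_dvd:
  assumes "primitive_root_of_unity d z" "z ^ n = 1"
  shows "d dvd n"
proof -
  have "z ^ n = (z ^ d) ^ (n div d) * z ^ (n mod d)"
    by (metis mult_div_mod_eq power_add power_mult)
  also have "\<dots> = z ^ (n mod d)"
    using assms(1) by (simp add: primitive_root_of_unity_def)
  finally have "z ^ (n mod d) = 1" using assms(2) by simp
  moreover have "n mod d < d" using assms(1) by (simp add: primitive_root_of_unity_def)
  ultimately show ?thesis
    using assms(1) by (auto simp: primitive_root_of_unity_def dvd_eq_mod_eq_0)
qed

lemma roots_unity_partition:
  assumes "n > 0"
  shows "{z::complex. z ^ n = 1} = (\<Union>d\<in>{d. d dvd n}. {z. primitive_root_of_unity d z})"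
proof (intro equalityI subsetI)
  fix z :: complex assume z: "z \<in> {z. z ^ n = 1}"
  define d where "d = (LEAST k. 0 < k \<and> z ^ k = 1)"
  have d: "0 < d \<and> z ^ d = 1"
    unfolding d_def by (rule LeastI[of _ n]) (use z assms in auto)
  have "primitive_root_of_unity d z"
    using d not_less_Least[of _ "\<lambda>k. 0 < k \<and> z ^ k = 1"]
    by (auto simp: primitive_root_of_unity_def d_def)
  then show "z \<in> (\<Union>d\<in>{d. d dvd n}. {z. primitive_root_of_unity d z})"
    using primitive_root_dvd z by auto
next
  fix z assume "z \<in> (\<Union>d\<in>{d. d dvd n}. {z. primitive_root_of_unity d z})"
  then obtain d k where "n = d * k" "z ^ d = 1"
    by (auto simp: primitive_root_of_unity_def)
  then show "z \<in> {z. z ^ n = 1}" by (simp add: power_mult)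
qed

lemma prod_complex_cyclotomic:
  assumes "n > 0"
  shows "(\<Prod>d | d dvd n. complex_cyclotomic d) = Polynomial.monom 1 n - 1"
proof -
  let ?p = "Polynomial.monom 1 n - 1 :: complex poly"
  have roots: "{z. poly ?p z = 0} = {z. z ^ n = 1}"
    by (auto simp: poly_monom)
  have deg: "Polynomial.degree ?p = n"
    using assms degree_add_eq_left[of "- 1" "Polynomial.monom (1::complex) n"]
    by (simp add: degree_monom_eq)
  have lc: "lead_coeff ?p = 1"
    using assms unfolding deg by simp
  have "rsquarefree ?p"
    unfolding rsquarefree_roots
  proof (intro allI notI)
    fix a assume "poly ?p a = 0 \<and> poly (pderiv ?p) a = 0"
    then have "a ^ n = 1" "of_nat n * a ^ (n - 1) = 0"
      by (auto simp: poly_monom pderiv_diff pderiv_monom)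
    then show False using assms by (auto simp: power_0_left)
  qed
  from complex_poly_decompose_rsquarefree[OF this]
  have "?p = (\<Prod>z | z ^ n = 1. [:- z, 1:])"
    unfolding lc roots by simp
  also have "\<dots> = (\<Prod>d | d dvd n. complex_cyclotomic d)"
    unfolding roots_unity_partition[OF assms] complex_cyclotomic_def
  proof (rule prod.UNION_disjoint)
    show "finite {d. d dvd n}" using assms by simp
    show "\<forall>d\<in>{d. d dvd n}. finite {z. primitive_root_of_unity d z}"
      using finite_primitive_roots by blast
    show "\<forall>d\<in>{d. d dvd n}. \<forall>e\<in>{d. d dvd n}. d \<noteq> e \<longrightarrow>
        {z. primitive_root_of_unity d z} \<inter> {z. primitive_root_of_unity e z} = {}"
    proof (intro ballI impI equals0I)
      fix d e z assume "d \<noteq> e"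
        and "z \<in> {z. primitive_root_of_unity d z} \<inter> {z. primitive_root_of_unity e z}"
      moreover from this have "z ^ d = 1" "z ^ e = 1"
        by (simp_all add: primitive_root_of_unity_def)
      ultimately show False
        using primitive_root_dvd[of d z e] primitive_root_dvd[of e z d] dvd_antisym[of d e] by simp
    qed
  qed
  finally show ?thesis by simp
qed

lemma complex_cyclotomic_monic: "lead_coeff (complex_cyclotomic d) = 1"
  unfolding complex_cyclotomic_def by (simp add: lead_coeff_prod)

lemma complex_cyclotomic_integral: "\<exists>p. map_poly of_int p = complex_cyclotomic n"
proof (induction n rule: less_induct)
  case (less n)
  show ?case
  proof (cases "n = 0")
    case True
    then show ?thesis
      by (intro exI[of _ 1]) (simp add: complex_cyclotomic_def primitive_root_of_unity_def of_int_poly_one)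
  next
    case False
    let ?D = "{d. d dvd n \<and> d \<noteq> n}"
    have fin: "finite ?D" using False by auto
    have "\<forall>d\<in>?D. \<exists>p. map_poly of_int p = complex_cyclotomic d"
      using less False by (auto dest!: dvd_imp_le)
    then obtain f where f: "\<And>d. d \<in> ?D \<Longrightarrow> map_poly of_int (f d) = complex_cyclotomic d"
      by metis
    define g where "g = prod f ?D"
    define G where "G = (map_poly of_int g :: complex poly)"
    have G: "G = (\<Prod>d\<in>?D. complex_cyclotomic d)"
      unfolding G_def g_def using fin f by (simp add: of_int_poly_prod)
    have "lead_coeff G = 1" unfolding G by (simp add: lead_coeff_prod complex_cyclotomic_monic)
    then have lcg: "lead_coeff g = 1" 
      unfolding G_def by (simp add: of_int_poly_degree coeff_map_poly)
    then have g0: "g \<noteq> 0" by auto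
    obtain q r where qr: "pseudo_divmod (Polynomial.monom 1 n - 1) g = (q, r)" by force
    from pseudo_divmod[OF g0 qr] lcg
    have e: "Polynomial.monom 1 n - 1 = g * q + r"
      and d: "r = 0 \<or> Polynomial.degree r < Polynomial.degree g" by auto
    let ?c = "map_poly of_int :: int poly \<Rightarrow> complex poly"
    have "{d. d dvd n} = insert n ?D" by auto
    then have "G * complex_cyclotomic n = Polynomial.monom 1 n - 1"
      using prod_complex_cyclotomic[of n] False fin unfolding G by (simp add: mult.commute)
    also have "\<dots> = ?c (Polynomial.monom 1 n - 1)"
      by (simp add: of_int_poly_diff of_int_poly_monom of_int_poly_one)
    also have "\<dots> = G * ?c q + ?c r"
      unfolding e G_def by (simp add: of_int_poly_add of_int_poly_mult)
    finally have eq: "G * (complex_cyclotomic n - ?c q) = ?c r"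
      by (simp add: algebra_simps)
    have G0: "G \<noteq> 0" using \<open>lead_coeff G = 1\<close> by auto
    have "complex_cyclotomic n - ?c q = 0"
    proof (rule ccontr)
      assume h: "complex_cyclotomic n - ?c q \<noteq> 0"
      then have "Polynomial.degree (?c r) \<ge> Polynomial.degree G"
        unfolding eq[symmetric] using G0 by (simp add: degree_mult_eq)
      then have "r = 0" using d by (simp add: G_def of_int_poly_degree)
      then have "G * (complex_cyclotomic n - ?c q) = 0" using eq by simp
      then show False using h G0 by simp
    qed
    then show ?thesis by auto
  qed
qed

lemma of_int_cyclotomic: "map_poly of_int (cyclotomic d) = complex_cyclotomic d"
  unfolding cyclotomic_def
  by (rule theI') (use complex_cyclotomic_integral of_int_poly_inject in metis)

lemma cyclotomic_nonzero: "cyclotomic d \<noteq> 0"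
  using of_int_cyclotomic[of d] complex_cyclotomic_monic[of d] by auto


section \<open>The rings\<close>

definition Q_poly :: "int poly \<Rightarrow> (nat \<Rightarrow> complex) \<Rightarrow> nat \<Rightarrow> int poly" where
  "Q_poly P \<zeta> N = (\<Prod>d | d dvd N \<and> poly (map_poly of_int P) (\<zeta> d) ^ N = 1. cyclotomic d)"

lemma Q_poly_nonzero: "Q_poly P \<zeta> N \<noteq> 0"
  by (cases "finite {d. d dvd N \<and> poly (map_poly of_int P) (\<zeta> d) ^ N = 1}")
     (auto simp: Q_poly_def cyclotomic_nonzero)

text \<open>
  \<open>int_poly_localization Q\<close> is \<open>\<int>[T, Q\<^sup>-\<^sup>1]\<close> for nonzero \<open>Q\<close>, realised inside the fraction field
  of \<open>\<int>[T]\<close> as the ring of all fractions \<open>p / Q\<^sup>k\<close>.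
\<close>

definition int_poly_localization :: "int poly \<Rightarrow> int poly fract ring" where
  "int_poly_localization Q =
     \<lparr>carrier = {to_fract p / to_fract Q ^ k | p k. True},
      mult = (*), one = 1, zero = 0, add = (+)\<rparr>"

lemma cring_int_poly_localization:
  assumes "Q \<noteq> 0"
  shows "cring (int_poly_localization Q)"
proof -
  have q: "to_fract Q \<noteq> 0" using assms by simp
  have pow: "to_fract (a ^ k) = to_fract a ^ k" for a :: "int poly" and k
    by (induction k) auto
  have add: "\<exists>r m. to_fract p / to_fract Q ^ k + to_fract p' / to_fract Q ^ k' = to_fract r / to_fract Q ^ m"
    for p p' k k'
    by (rule exI[of _ "p * Q ^ k' + p' * Q ^ k"], rule exI[of _ "k + k'"])
       (use q in \<open>simp add: pow power_add field_simps\<close>)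
  have mult: "\<exists>r m. to_fract p / to_fract Q ^ k * (to_fract p' / to_fract Q ^ k') = to_fract r / to_fract Q ^ m"
    for p p' k k'
    by (rule exI[of _ "p * p'"], rule exI[of _ "k + k'"]) (simp add: power_add)
  have neg: "\<exists>r m. - (to_fract p / to_fract Q ^ k) = to_fract r / to_fract Q ^ m" for p k
    by (rule exI[of _ "- p"], rule exI[of _ k]) simp
  have zo: "\<exists>p k. (0 :: int poly fract) = to_fract p / to_fract Q ^ k"
      "\<exists>p k. (1 :: int poly fract) = to_fract p / to_fract Q ^ k"
    by (rule exI[of _ 0], simp) (rule exI[of _ 1], rule exI[of _ 0], simp)
  let ?R = "int_poly_localization Q"
  have sel: "x \<in> carrier ?R \<longleftrightarrow> (\<exists>p k. x = to_fract p / to_fract Q ^ k)"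
      "x \<otimes>\<^bsub>?R\<^esub> y = x * y" "x \<oplus>\<^bsub>?R\<^esub> y = x + y" "\<one>\<^bsub>?R\<^esub> = 1" "\<zero>\<^bsub>?R\<^esub> = 0" for x y
    by (auto simp: int_poly_localization_def)
  have closed: "x + y \<in> carrier ?R" "x * y \<in> carrier ?R" "- x \<in> carrier ?R"
    if "x \<in> carrier ?R" "y \<in> carrier ?R" for x y
    using that add mult neg unfolding sel by blast+
  have zo': "0 \<in> carrier ?R" "1 \<in> carrier ?R"
    using zo unfolding sel by blast+
  show ?thesis
  proof (rule cringI)
    show "abelian_group ?R"
    proof (rule abelian_groupI)
      fix x assume x: "x \<in> carrier ?R"
      then show "\<exists>y\<in>carrier ?R. y \<oplus>\<^bsub>?R\<^esub> x = \<zero>\<^bsub>?R\<^esub>"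
        by (intro bexI[of _ "- x"]) (simp_all add: sel(2-) closed)
    qed (simp_all add: sel(2-) closed zo' add_ac)
    show "Group.comm_monoid ?R"
      by (rule comm_monoidI) (simp_all add: sel(2-) closed zo' mult_ac)
  qed (simp add: sel(2-) distrib_right)
qed

definition quotient_ring :: "int poly \<Rightarrow> (nat \<Rightarrow> complex) \<Rightarrow> nat \<Rightarrow> int poly fract set ring" where
  "quotient_ring P \<zeta> N =
     (let R = int_poly_localization (Q_poly P \<zeta> N)
      in R Quot (Idl\<^bsub>R\<^esub> {to_fract ([:0, 1:] ^ N - 1), to_fract (P ^ N - 1)}))"

end

theory Submission
  imports Defs "Jordan_Normal_Form.Determinant"
begin

text \<open>
  Write \<open>T\<^sup>N - 1 = Q R\<close> with \<open>Q = Q\<^sub>N\<close> and put \<open>B = P\<^sup>N - 1\<close>. Inverting \<open>Q\<close> puts \<open>R\<close> into the ideal, and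
  the localised quotient is a quotient of \<open>\<int>[T]/(R, B)\<close>: powers of \<open>Q\<close> repeat in the latter
  finite ring, so \<open>1/Q\<close> becomes a polynomial. The order of \<open>\<int>[T]/(R, B)\<close> is at most the resultant
  \<open>\<Prod>\<bar>P(z)\<^sup>N - 1\<bar>\<close> over the at most \<open>N\<close> roots \<open>z\<close> of \<open>R\<close>, which is at most \<open>(2 L\<^sup>N)\<^sup>N\<close> for a bound
  \<open>L \<ge> 1\<close> of \<open>\<bar>P\<bar>\<close> on the unit circle. The resultant is nonzero because the condition \<open>P(z)\<^sup>N = 1\<close> is
  invariant under conjugation of primitive roots of unity, by Dedekind's argument for the
  irreducibility of cyclotomic polynomials.
\<close>

section \<open>Frobenius congruences modulo a prime\<close>

text \<open>Every binomial coefficient strictly between the two ends is divisible by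
  \<open>p\<close>. The general ring type serves both the integers and \<open>Z[T]\<close>.\<close>

lemma prime_dvd_power_add:
  fixes x y :: "'a :: comm_ring_1"
  assumes "prime p"
  shows "of_nat p dvd (x + y) ^ p - x ^ p - y ^ p"
proof -
  have p: "p > 0" using assms by (simp add: prime_gt_0_nat)
  have "(x + y) ^ p = (\<Sum>k\<in>{..p}. of_nat (p choose k) * x ^ k * y ^ (p - k))"
    by (rule binomial_ring)
  also have "{..p} = insert 0 (insert p {0<..<p})" using p by auto
  also have "(\<Sum>k\<in>\<dots>. of_nat (p choose k) * x ^ k * y ^ (p - k))
      = y ^ p + (x ^ p + (\<Sum>k\<in>{0<..<p}. of_nat (p choose k) * x ^ k * y ^ (p - k)))"
    using p by simp
  finally have "(x + y) ^ p - x ^ p - y ^ p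
      = (\<Sum>k\<in>{0<..<p}. of_nat (p choose k) * x ^ k * y ^ (p - k))" by simp
  moreover have "of_nat p dvd (\<Sum>k\<in>{0<..<p}. of_nat (p choose k) * x ^ k * y ^ (p - k))"
  proof (intro dvd_sum)
    fix k assume "k \<in> {0<..<p}"
    then have "p dvd (p choose k)" using assms by (intro dvd_choose_prime) auto
    then have "(of_nat p :: 'a) dvd of_nat (p choose k)" by (auto elim!: dvdE)
    then show "of_nat p dvd of_nat (p choose k) * x ^ k * y ^ (p - k)" by (simp add: mult.assoc)
  qed
  ultimately show ?thesis by simp
qed

text \<open>Fermat's little theorem, by induction in both directions from 0; each step is additivity
  of the \<open>p\<close>-th power with one summand equal to 1.\<close>

lemma prime_dvd_power_minus_self_int:
  fixes a :: int
  assumes "prime p"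
  shows "int p dvd a ^ p - a"
proof -
  have p: "p > 0" using assms by (simp add: prime_gt_0_nat)
  show ?thesis
  proof (induction a rule: int_induct[of _ 0])
    case base
    then show ?case using p by (simp add: power_0_left)
  next
    case (step1 i)
    then show ?case using dvd_add[OF prime_dvd_power_add[OF assms, of i 1] step1(2)]
      by (simp add: algebra_simps)
  next
    case (step2 i)
    then show ?case using dvd_diff[OF step2(2) prime_dvd_power_add[OF assms, of "i - 1" 1]]
      by (simp add: algebra_simps)
  qed
qed

text \<open>Modulo \<open>p\<close> the \<open>p\<close>-th power is additive and multiplicative and
  fixes constants, so it only replaces \<open>T\<close> by \<open>T^p\<close>. The induction splits
  a polynomial as a constant plus \<open>T\<close> times a shorter one.\<close>

lemma prime_dvd_pcompose_monom_minus_power: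
  fixes q :: "int poly"
  assumes "prime p"
  shows "of_nat p dvd q \<circ>\<^sub>p Polynomial.monom 1 p - q ^ p"
proof (induction q)
  case 0
  then show ?case using assms by (simp add: power_0_left prime_gt_0_nat)
next
  case (pCons a q)
  let ?X = "[:0, 1:] :: int poly"
  have X: "?X ^ p = Polynomial.monom 1 p"
    by (simp add: monom_altdef)
  have e: "pCons a q = [:a:] + ?X * q" by simp
  have 1: "of_nat p dvd [:a:] ^ p - [:a:]"
  proof -
    obtain b where "a ^ p - a = int p * b"
      using prime_dvd_power_minus_self_int[OF assms, of a] by (elim dvdE)
    then have e: "[:a:] ^ p - [:a:] = of_nat p * [:b:]"
      by (simp add: poly_const_pow of_nat_poly)
    show ?thesis unfolding e by (rule dvd_triv_left)
  qed
  have 2: "of_nat p dvd Polynomial.monom 1 p * (q \<circ>\<^sub>p Polynomial.monom 1 p - q ^ p)"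
    using pCons.IH by simp
  have 3: "of_nat p dvd (pCons a q) ^ p - [:a:] ^ p - Polynomial.monom 1 p * q ^ p"
    using prime_dvd_power_add[OF assms, of "[:a:]" "?X * q"]
    unfolding e[symmetric] power_mult_distrib X .
  have "pCons a q \<circ>\<^sub>p Polynomial.monom 1 p - pCons a q ^ p
     = Polynomial.monom 1 p * (q \<circ>\<^sub>p Polynomial.monom 1 p - q ^ p)
       - ([:a:] ^ p - [:a:]) - ((pCons a q) ^ p - [:a:] ^ p - Polynomial.monom 1 p * q ^ p)"
    by (simp add: pcompose_pCons algebra_simps)
  then show ?case using dvd_diff[OF dvd_diff[OF 2 1] 3] by (simp only:)
qed

section \<open>Evaluation at complex numbers and minimal polynomials over the integers\<close>

abbreviation ev :: "int poly \<Rightarrow> complex \<Rightarrow> complex" where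
  "ev p z \<equiv> poly (map_poly of_int p) z"

lemma ev_simps [simp]:
  "ev (p + q) z = ev p z + ev q z"
  "ev (p - q) z = ev p z - ev q z"
  "ev (p * q) z = ev p z * ev q z"
  "ev (p ^ n) z = ev p z ^ n"
  "ev 1 z = 1"
  "ev (of_nat n) z = of_nat n"
  "ev (Polynomial.smult a p) z = of_int a * ev p z"
  "ev (Polynomial.monom a n) z = of_int a * z ^ n"
  "ev (- p) z = - ev p z"
  "ev (p \<circ>\<^sub>p q) z = ev p (ev q z)"
proof -
  show mult: "ev (p * q) z = ev p z * ev q z" for p q by (simp add: of_int_poly_mult)
  show add: "ev (p + q) z = ev p z + ev q z" for p q by (simp add: of_int_poly_add)
  show one: "ev 1 z = 1" by (simp add: of_int_poly_one)
  show "ev (p ^ n) z = ev p z ^ n" by (induction n) (simp_all only: power_0 power_Suc one mult)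
  show "ev (of_nat n) z = of_nat n" 
    by (induction n) (simp_all only: of_nat_0 of_nat_Suc add one, simp)
  show "ev (Polynomial.smult a p) z = of_int a * ev p z" 
    by (subst map_poly_smult) auto
  show "ev (p - q) z = ev p z - ev q z" by (simp add: of_int_poly_diff)
  show "ev (Polynomial.monom a n) z = of_int a * z ^ n" by (simp add: of_int_poly_monom poly_monom)
  show "ev (- p) z = - ev p z" using add[of p "- p"] by (simp add: eq_neg_iff_add_eq_0 add.commute)
  show "ev (p \<circ>\<^sub>p q) z = ev p (ev q z)"
    by (induction p) (simp_all add: pcompose_pCons add mult map_poly_pCons)
qed

text \<open>Pseudo-division scales the dividend by a power of the leading coefficient of the
  divisor, which is 1 here.\<close>

lemma monic_division:
  fixes f :: "'a :: comm_ring_1 poly"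
  assumes "lead_coeff f = 1"
  obtains q r where "p = f * q + r" "r = 0 \<or> Polynomial.degree r < Polynomial.degree f"
proof (cases "f = 0")
  case False
  obtain q r where qr: "pseudo_divmod p f = (q, r)" by force
  show ?thesis using that[of q r] pseudo_divmod[OF False qr] assms by simp
next
  case True
  then show ?thesis using that[of 0 p] assms by simp
qed

text \<open>Gauss's lemma: \<open>c\<close> is a unit over the fraction field, and divisibility by a
  primitive polynomial descends from there to \<open>Z[T]\<close>.\<close>

lemma primitive_dvd_smultD:
  fixes f g :: "int poly"
  assumes "content f = 1" "c \<noteq> 0" "f dvd Polynomial.smult c g"
  shows "f dvd g"
proof (rule fract_poly_dvdD[OF _ assms(1)])
  have "fract_poly f dvd Polynomial.smult (to_fract c) (fract_poly g)"
    using fract_poly_dvd[OF assms(3)] by simp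
  then show "fract_poly f dvd fract_poly g" 
    using assms(2) by (simp add: dvd_smult_iff)
qed

text \<open>The witness is the primitive part of a nonzero annihilator of \<open>z\<close> of least
  degree. Pseudo-remainders by it vanish by minimality, and primitivity removes the scaling constant
  of pseudo-division.\<close>

lemma primitive_min_poly_exists:
  fixes S :: "int poly"
  assumes "S \<noteq> 0" "ev S z = 0"
  obtains f where "f \<noteq> 0" "ev f z = 0" "\<And>g. ev g z = 0 \<Longrightarrow> f dvd g"
proof -
  obtain f0 where f0: "f0 \<noteq> 0" "ev f0 z = 0" 
    and min: "\<And>g. g \<noteq> 0 \<Longrightarrow> ev g z = 0 \<Longrightarrow> Polynomial.degree f0 \<le> Polynomial.degree g"
    using ex_has_least_nat[of "\<lambda>f. f \<noteq> 0 \<and> ev f z = 0" S Polynomial.degree] assms by blast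
  define f where "f = primitive_part f0"
  have c: "f0 = Polynomial.smult (content f0) f" unfolding f_def by simp
  have f: "f \<noteq> 0" "content f = 1" "Polynomial.degree f = Polynomial.degree f0"
    using f0 by (auto simp: f_def)
  have "of_int (content f0) * ev f z = 0" unfolding ev_simps(7)[symmetric] c[symmetric] by (rule f0(2))
  then have evf: "ev f z = 0" using f0(1) by simp
  have "f dvd g" if g: "ev g z = 0" for g
  proof -
    obtain q r where qr: "pseudo_divmod g f = (q, r)" by force
    let ?c = "Polynomial.coeff f (Polynomial.degree f) ^ (Suc (Polynomial.degree g) - Polynomial.degree f)"
    from pseudo_divmod[OF f(1) qr] 
    have e: "Polynomial.smult ?c g = f * q + r" and d: "r = 0 \<or> Polynomial.degree r < Polynomial.degree f" by auto
    have "ev r z = 0" using arg_cong[OF e, of "\<lambda>p. ev p z"] g evf by simp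
    then have "r = 0" using d min[of r] f(3) by linarith
    then have "f dvd Polynomial.smult ?c g" unfolding e by simp
    moreover have "?c \<noteq> 0" using f(1) by simp
    ultimately show ?thesis using f(2) primitive_dvd_smultD by blast
  qed
  with f(1) evf show ?thesis by (rule that)
qed


lemma ev_pderiv_mult: "ev (pderiv (p * q)) z = ev (pderiv p) z * ev q z + ev p z * ev (pderiv q) z"
  by (simp add: pderiv_mult algebra_simps)

section \<open>Conjugation of roots of unity\<close>

text \<open>Dedekind's argument. Write \<open>T^n - 1 = f h\<close>, where \<open>f\<close> is the
  minimal polynomial of \<open>z\<close>. If \<open>z^p\<close> is a root of \<open>f\<close>, it is
  a root of the multiple \<open>S\<close> of \<open>f\<close>; if it is a root of \<open>h\<close>,
  then \<open>p\<close> would divide \<open>n\<close>.\<close>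

lemma prime_conjugate:
  fixes S :: "int poly"
  assumes z: "z ^ n = 1" and n: "n > 0" and p: "prime p" "\<not> p dvd n" and S: "ev S z = 0"
  shows "ev S (z ^ p) = 0"
proof -
  let ?A = "Polynomial.monom 1 n - 1 :: int poly"
  have degA: "Polynomial.degree ?A = n" and lcA: "lead_coeff ?A = 1"
  proof -
    show deg: "Polynomial.degree ?A = n"
      using n degree_add_eq_left[of "- 1" "Polynomial.monom (1::int) n"] by (simp add: degree_monom_eq)
    show "lead_coeff ?A = 1" unfolding deg using n by simp
  qed
  have A0: "?A \<noteq> 0" using lcA by (metis leading_coeff_0_iff zero_neq_one)
  have evA: "ev ?A w = w ^ n - 1" for w by simp
  obtain f where f: "f \<noteq> 0" "ev f z = 0" and dvdI: "\<And>g. ev g z = 0 \<Longrightarrow> f dvd g"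
    using primitive_min_poly_exists[of ?A z] A0 z evA by auto
  have "f dvd ?A" by (rule dvdI) (simp only: evA z, simp)
  then obtain h where h: "?A = f * h" by (elim dvdE)
  have "ev f (z ^ p) * ev h (z ^ p) = ev ?A (z ^ p)" unfolding h by simp
  also have "\<dots> = 0" unfolding evA using z by (metis cancel_comm_monoid_add_class.diff_cancel mult.commute power_mult power_one)
  finally consider "ev f (z ^ p) = 0" | "ev h (z ^ p) = 0" by auto
  then show ?thesis
  proof cases
    case 1
    have "f dvd S" using S by (rule dvdI)
    then show ?thesis using 1 by (elim dvdE) simp
  next
    case 2
    \<comment> \<open>Since \<open>h(z^p) = 0\<close>, the congruence between \<open>h(T^p)\<close>
      and \<open>h^p\<close> makes \<open>h(z)^p\<close> a multiple of \<open>p\<close> in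
      \<open>Z[z]\<close>.\<close>
    obtain u where "h \<circ>\<^sub>p Polynomial.monom 1 p - h ^ p = of_nat p * u"
      using prime_dvd_pcompose_monom_minus_power[OF p(1), of h] by (elim dvdE)
    from arg_cong[OF this, of "\<lambda>q. ev q z"] have "ev h (z ^ p) - ev h z ^ p = of_nat p * ev u z"
      by simp
    then have hp: "ev h z ^ p = - of_nat p * ev u z"
      unfolding 2 by (simp add: minus_equation_iff[of "ev h z ^ p"])
    \<comment> \<open>Modulo \<open>p\<close> the root \<open>z\<close> of \<open>f\<close> is also a root of \<open>h\<close>, hence a double root of \<open>T\<^sup>n - 1\<close>, so \<open>p dvd n\<close>.\<close>
    have "ev (pderiv ?A) z = ev (pderiv f) z * ev h z"
      unfolding h ev_pderiv_mult using f by simp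
    moreover have "pderiv ?A = Polynomial.monom (int n) (n - 1)"
      by (simp add: pderiv_diff pderiv_monom)
    ultimately have "of_nat n * z ^ (n - 1) = ev (pderiv f) z * ev h z"
      by simp
    \<comment> \<open>The \<open>p\<close>-th power is taken because divisibility by
      \<open>p\<close> is known for \<open>h(z)^p\<close> only, not for \<open>h(z)\<close>. The
      extra factor \<open>z\<close> turns \<open>z^(n-1)\<close> into
      \<open>z^n = 1\<close>.\<close>
    then have "(of_nat n * z ^ (n - 1) * z) ^ p = (ev (pderiv f) z * ev h z * z) ^ p" by simp
    also have "of_nat n * z ^ (n - 1) * z = of_nat n"
      using power_minus_mult[OF n, of z] z by (simp add: mult.assoc)
    also have "(ev (pderiv f) z * ev h z * z) ^ p = ev (pderiv f) z ^ p * (ev h z ^ p) * z ^ p"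
      by (simp only: power_mult_distrib)
    also have "\<dots> = of_nat p * ev (- (pderiv f ^ p) * u * Polynomial.monom 1 p) z"
      unfolding hp by simp
    finally have "\<exists>w. of_nat n ^ p = of_nat p * ev w z" by (rule exI)
    then obtain w where w: "of_nat n ^ p = of_nat p * ev w z" by (elim exE)
    have "lead_coeff f * lead_coeff h = 1" using lcA unfolding h by (simp add: lead_coeff_mult)
    then have "lead_coeff f = 1 \<or> lead_coeff f = -1" by (simp add: zmult_eq_1_iff) blast
    \<comment> \<open>\<open>f\<close> is monic up to sign; passing to the monic associate allows
      division with remainder.\<close>
    then have "\<exists>F. lead_coeff F = 1 \<and> F dvd f \<and> f dvd F"
    proof
      assume "lead_coeff f = 1"
      then show ?thesis by (intro exI[of _ f]) simp
    next
      assume "lead_coeff f = - 1"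
      then show ?thesis by (intro exI[of _ "- f"]) simp
    qed
    then obtain F where F: "lead_coeff F = 1" "F dvd f" "f dvd F" by blast
    obtain q r where w': "w = F * q + r" and r: "r = 0 \<or> Polynomial.degree r < Polynomial.degree F"
      using monic_division[OF F(1)] .
    obtain F' where "F = f * F'" using F(3) by (rule dvdE)
    then have evF: "ev F z = 0" using f(2) by simp
    have F0: "Polynomial.degree F > 0"
    proof (rule ccontr)
      assume "\<not> ?thesis"
      then obtain c where "F = [:c:]" by (auto elim: degree_eq_zeroE)
      then show False using F(1) evF by (simp add: map_poly_pCons)
    qed
    \<comment> \<open>The relation \<open>n^p = p w(z)\<close> is lifted to polynomials:
      \<open>?g\<close> vanishes at \<open>z\<close> and has smaller degree than \<open>F\<close>,
      so it is zero. Its constant coefficient then shows that \<open>p\<close> divides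
      \<open>n^p\<close>.\<close>
    let ?g = "of_nat p * r - of_nat (n ^ p)"
    have "ev ?g z = 0" using w unfolding w' by (simp add: evF)
    then have "F dvd ?g" by (rule dvd_trans[OF F(2) dvdI])
    moreover have "Polynomial.degree ?g < Polynomial.degree F"
    proof (rule degree_diff_less)
      have "of_nat p * r = Polynomial.smult (int p) r" by (simp add: of_nat_poly)
      then show "Polynomial.degree (of_nat p * r) < Polynomial.degree F"
        using r F0 by (metis degree_0 degree_smult_le le_less_trans)
      show "Polynomial.degree (of_nat (n ^ p)) < Polynomial.degree F" using F0 by (simp del: of_nat_power)
    qed
    ultimately have "?g = 0" using dvd_imp_degree_le not_le by blast
    then have "of_nat p * r = of_nat (n ^ p)" by simp
    then have "Polynomial.coeff (of_nat p * r) 0 = Polynomial.coeff (of_nat (n ^ p)) 0" by (rule arg_cong)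
    then have e: "int p * Polynomial.coeff r 0 = int (n ^ p)"
      by (simp add: of_nat_poly coeff_mult)
    have "int p dvd int (n ^ p)" unfolding e[symmetric] by simp
    then have "p dvd n ^ p" by (simp only: int_dvd_int_iff)
    then have "p dvd n" using p(1) prime_dvd_power by blast
    then show ?thesis using p(2) by contradiction
  qed
qed

text \<open>One prime factor of \<open>k\<close> is split off at a time; \<open>z\<close> is
  generalised because the induction continues from \<open>z ^ p\<close>.\<close>

lemma coprime_conjugate:
  fixes S :: "int poly"
  assumes z: "z ^ n = 1" and n: "n > 0" and k: "coprime k n" "k > 0" and S: "ev S z = 0"
  shows "ev S (z ^ k) = 0"
  using k z S
proof (induction k arbitrary: z rule: less_induct)
  case (less k)
  show ?case
  proof (cases "k = 1")
    case False
    then obtain p where p: "prime p" "p dvd k" using prime_factor_nat by blast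
    then obtain l where l: "k = p * l" by (elim dvdE)
    have "\<not> p dvd n" using p less.prems(1) by (meson coprime_common_divisor not_prime_unit)
    then have "ev S (z ^ p) = 0" using prime_conjugate less.prems n p by blast
    moreover have "(z ^ p) ^ n = 1" using less.prems(3) by (metis power_mult mult.commute power_one)
    moreover have "l < k" "coprime l n" "l > 0"
      using less.prems l prime_gt_1_nat[OF p(1)] by auto
    ultimately have "ev S ((z ^ p) ^ l) = 0" using less.IH[of l "z ^ p"] by blast
    then show ?thesis by (simp add: l power_mult)
  qed (use less.prems in simp)
qed

text \<open>By counting, the powers of \<open>z\<close> exhaust the \<open>d\<close>-th roots of
  unity. A common factor of the exponent and \<open>d\<close> would make the order of
  \<open>w\<close> smaller than \<open>d\<close>.\<close>

lemma primitive_root_power: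
  assumes z: "primitive_root_of_unity d z" and w: "primitive_root_of_unity d w"
  obtains k where "coprime k d" "k > 0" "w = z ^ k"
proof -
  have d: "d > 0" and zd: "z ^ d = 1" using z by (auto simp: primitive_root_of_unity_def)
  \<comment> \<open>Exponents run from 1 to \<open>d\<close> rather than from 0, which secures
    \<open>k > 0\<close> also for \<open>d = 1\<close>.\<close>
  have inj: "inj_on (\<lambda>i. z ^ i) {1..d}"
  proof (rule linorder_inj_onI)
    fix i j assume ij: "i < j" "i \<in> {1..d}" "j \<in> {1..d}"
    show "z ^ i \<noteq> z ^ j"
    proof
      assume "z ^ i = z ^ j"
      moreover have "z ^ j = z ^ i * z ^ (j - i)" using ij by (simp flip: power_add)
      moreover have "z \<noteq> 0" using zd d by (auto simp: power_0_left)
      ultimately have "z ^ (j - i) = 1" by simp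
      then have "d dvd j - i" using primitive_root_dvd z by blast
      then show False using ij by (auto dest: dvd_imp_le)
    qed
  qed auto
  have "(\<lambda>i. z ^ i) ` {1..d} = {x. x ^ d = 1}"
  proof (rule card_subset_eq)
    show "finite {x::complex. x ^ d = 1}" using finite_roots_unity[of d] d by simp
    show "(\<lambda>i. z ^ i) ` {1..d} \<subseteq> {x. x ^ d = 1}"
      using zd by (auto simp: power_mult[symmetric] mult.commute) (metis mult.commute power_mult power_one)
    show "card ((\<lambda>i. z ^ i) ` {1..d}) = card {x::complex. x ^ d = 1}"
      using card_image[OF inj] card_roots_unity_eq[of d] d by simp
  qed
  then obtain k where k: "k \<in> {1..d}" "w = z ^ k"
    using w unfolding primitive_root_of_unity_def by blast
  have "coprime k d"
  proof (rule ccontr)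
    assume "\<not> coprime k d"
    let ?g = "gcd k d"
    have g: "?g > 1" using \<open>\<not> coprime k d\<close> d by (simp add: coprime_iff_gcd_eq_1 nat_neq_iff)
    have "k * (d div ?g) = d * (k div ?g)"
      by (metis div_mult_swap gcd_dvd1 gcd_dvd2 mult.commute)
    then have "w ^ (d div ?g) = (z ^ d) ^ (k div ?g)"
      unfolding k(2) power_mult[symmetric] by simp
    then have "w ^ (d div ?g) = 1" using zd by simp
    then have "d dvd d div ?g" using primitive_root_dvd w by blast
    then have "d \<le> d div ?g" using d g by (intro dvd_imp_le) (auto simp: div_greater_zero_iff)
    then show False using d g by (metis div_less_dividend not_less)
  qed
  then show ?thesis using that k by auto
qed

text \<open>With \<open>S = P^N - 1\<close>, this lets the condition in \<open>Q_poly\<close>,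
  tested at the single root \<open>\<zeta> d\<close>, decide for all primitive \<open>d\<close>-th
  roots.\<close>

lemma conjugate_roots_of_unity:
  fixes S :: "int poly"
  assumes "primitive_root_of_unity d z" "primitive_root_of_unity d w" "ev S z = 0"
  shows "ev S w = 0"
proof -
  obtain k where "coprime k d" "k > 0" "w = z ^ k"
    using primitive_root_power[OF assms(1,2)] .
  then show ?thesis
    using assms(1,3) by (auto intro: coprime_conjugate simp: primitive_root_of_unity_def)
qed

section \<open>Ideals of \<open>Z[T]\<close> and triangular bases\<close>

text \<open>A bare predicate is enough, since the quotient of \<open>Z[T]\<close> is never formed:
  only representatives modulo \<open>I\<close> are counted.\<close>

definition poly_ideal :: "int poly set \<Rightarrow> bool" where
  "poly_ideal I \<longleftrightarrow> 0 \<in> I \<and> (\<forall>a\<in>I. \<forall>b\<in>I. a + b \<in> I) \<and> (\<forall>a\<in>I. \<forall>q. q * a \<in> I)"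

lemma poly_ideal_smult: "poly_ideal I \<Longrightarrow> a \<in> I \<Longrightarrow> Polynomial.smult c a \<in> I"
  unfolding poly_ideal_def by (metis mult.left_neutral mult_smult_left)

lemma poly_ideal_add: "poly_ideal I \<Longrightarrow> a \<in> I \<Longrightarrow> b \<in> I \<Longrightarrow> a + b \<in> I"
  unfolding poly_ideal_def by blast

lemma poly_ideal_diff:
  assumes "poly_ideal I" "a \<in> I" "b \<in> I" shows "a - b \<in> I"
  using poly_ideal_add[OF assms(1,2) poly_ideal_smult[OF assms(1,3), of "-1"]] by simp

text \<open>Elimination from the top coefficient downwards: a multiple of \<open>g k\<close> brings
  position \<open>k\<close> into its range and changes only lower positions besides.\<close>

lemma reduce_to_box:
  fixes g :: "nat \<Rightarrow> int poly" and a :: "nat \<Rightarrow> int"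
  assumes I: "poly_ideal I"
    and g: "\<And>i. i < m \<Longrightarrow> g i \<in> I \<and> (\<forall>j>i. Polynomial.coeff (g i) j = 0) \<and> Polynomial.coeff (g i) i = a i \<and> a i > 0"
    and p: "\<forall>j\<ge>k. Polynomial.coeff p j = 0" and k: "k \<le> m"
  shows "\<exists>x. p - x \<in> I \<and> (\<forall>j<k. 0 \<le> Polynomial.coeff x j \<and> Polynomial.coeff x j < a j)
    \<and> (\<forall>j\<ge>k. Polynomial.coeff x j = 0)"
  using p k
proof (induction k arbitrary: p)
  case 0
  then have "p = 0" by (intro poly_eqI) simp
  then show ?case using I by (intro exI[of _ 0]) (simp add: poly_ideal_def)
next
  case (Suc k)
  define c where "c = Polynomial.coeff p k"
  \<comment> \<open>The remainder \<open>c mod a k\<close> is removed as well, so that position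
    \<open>k\<close> of \<open>p'\<close> is empty and the induction hypothesis applies;
    \<open>?x\<close> puts it back.\<close>
  define p' where "p' = p - Polynomial.smult (c div a k) (g k) - Polynomial.monom (c mod a k) k"
  have gk: "g k \<in> I" "\<forall>j>k. Polynomial.coeff (g k) j = 0" "Polynomial.coeff (g k) k = a k" "a k > 0"
    using g[of k] Suc.prems(2) by auto
  have "\<forall>j\<ge>k. Polynomial.coeff p' j = 0"
  proof (intro allI impI)
    fix j assume "j \<ge> k"
    then consider "j = k" | "j > k" by linarith
    then show "Polynomial.coeff p' j = 0"
    proof cases
      case 1
      then show ?thesis using gk by (simp add: p'_def c_def minus_mod_eq_div_mult[symmetric])
    next
      case 2
      then show ?thesis using gk Suc.prems(1) by (simp add: p'_def)
    qed
  qed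
  then obtain x where x: "p' - x \<in> I" "\<forall>j<k. 0 \<le> Polynomial.coeff x j \<and> Polynomial.coeff x j < a j"
      "\<forall>j\<ge>k. Polynomial.coeff x j = 0"
    using Suc.IH[of p'] Suc.prems(2) by auto
  let ?x = "x + Polynomial.monom (c mod a k) k"
  have "p - ?x = (p' - x) + Polynomial.smult (c div a k) (g k)" by (simp add: p'_def)
  then have "p - ?x \<in> I" using poly_ideal_add[OF I x(1) poly_ideal_smult[OF I gk(1)]] by (simp only:)
  moreover have "0 \<le> Polynomial.coeff ?x j \<and> Polynomial.coeff ?x j < a j" if "j < Suc k" for j
    using that x gk(4) by (cases "j = k") auto
  moreover have "Polynomial.coeff ?x j = 0" if "j \<ge> Suc k" for j
    using that x by simp
  ultimately show ?case by blast
qed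

text \<open>The same elimination, now exact: for elements of \<open>I\<close> the top coefficient is
  a multiple of \<open>a k\<close>, so no remainder is left.\<close>

lemma expand_in_basis:
  fixes g :: "nat \<Rightarrow> int poly" and a :: "nat \<Rightarrow> int"
  assumes I: "poly_ideal I"
    and g: "\<And>i. i < m \<Longrightarrow> g i \<in> I \<and> (\<forall>j>i. Polynomial.coeff (g i) j = 0) \<and> Polynomial.coeff (g i) i = a i"
    and dvd: "\<And>i h. i < m \<Longrightarrow> h \<in> I \<Longrightarrow> \<forall>j>i. Polynomial.coeff h j = 0 \<Longrightarrow> a i dvd Polynomial.coeff h i"
    and h: "h \<in> I" "\<forall>j\<ge>k. Polynomial.coeff h j = 0" and k: "k \<le> m"
  shows "\<exists>c. h = (\<Sum>i<k. Polynomial.smult (c i) (g i))"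
  using h k
proof (induction k arbitrary: h)
  case 0
  then have "h = 0" by (intro poly_eqI) simp
  then show ?case by simp
next
  case (Suc k)
  have gk: "g k \<in> I" "\<forall>j>k. Polynomial.coeff (g k) j = 0" "Polynomial.coeff (g k) k = a k"
    using g[of k] Suc.prems(3) by auto
  obtain b where b: "Polynomial.coeff h k = a k * b"
    using dvd[of k h] Suc.prems by (auto elim!: dvdE)
  let ?h = "h - Polynomial.smult b (g k)"
  have "?h \<in> I" using poly_ideal_diff[OF I Suc.prems(1) poly_ideal_smult[OF I gk(1)]] .
  moreover have "\<forall>j\<ge>k. Polynomial.coeff ?h j = 0"
  proof (intro allI impI)
    fix j assume "j \<ge> k"
    then consider "j = k" | "j > k" by linarith
    then show "Polynomial.coeff ?h j = 0"
      using gk b Suc.prems(2) by cases simp_all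
  qed
  ultimately obtain c where c: "?h = (\<Sum>i<k. Polynomial.smult (c i) (g i))"
    using Suc.IH[of ?h] Suc.prems(3) by auto
  then have "h = (\<Sum>i<k. Polynomial.smult (c i) (g i)) + Polynomial.smult b (g k)"
    by (simp add: algebra_simps)
  also have "\<dots> = (\<Sum>i<Suc k. Polynomial.smult ((c(k := b)) i) (g i))"
    by simp
  finally show ?case by blast
qed

text \<open>
  A Hermite normal form: \<open>g i\<close> has degree \<open>i\<close> and the least positive leading coefficient among the
  elements of \<open>I\<close> of degree \<open>i\<close>.
\<close>

lemma triangular_basis_exists:
  assumes I: "poly_ideal I" and n: "[:n:] \<in> I" "n \<noteq> 0"
  shows "\<exists>g. \<forall>i. g i \<in> I \<and> (\<forall>j>i. Polynomial.coeff (g i) j = 0) \<and> Polynomial.coeff (g i) i > 0 \<and>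
    (\<forall>h\<in>I. (\<forall>j>i. Polynomial.coeff h j = 0) \<longrightarrow> Polynomial.coeff (g i) i dvd Polynomial.coeff h i)"
proof -
  define T where "T i = {h\<in>I. \<forall>j>i. Polynomial.coeff h j = 0}" for i :: nat
  have "\<exists>f. f \<in> T i \<and> Polynomial.coeff f i > 0 \<and>
      (\<forall>h. h \<in> T i \<longrightarrow> Polynomial.coeff f i dvd Polynomial.coeff h i)" for i
  proof -
    \<comment> \<open>The nonzero constant, multiplied by \<open>T^i\<close>, provides a candidate
      with positive coefficient in each position \<open>i\<close>, so a least one exists.\<close>
    have "[:\<bar>n\<bar>:] \<in> I" using n poly_ideal_smult[OF I n(1), of "sgn n"] by (simp add: abs_sgn mult.commute)
    then have "Polynomial.monom 1 i * [:\<bar>n\<bar>:] \<in> I" using I by (auto simp: poly_ideal_def)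
    also have "Polynomial.monom 1 i * [:\<bar>n\<bar>:] = Polynomial.monom \<bar>n\<bar> i"
      by (simp add: smult_monom)
    finally have "Polynomial.monom \<bar>n\<bar> i \<in> T i \<and> Polynomial.coeff (Polynomial.monom \<bar>n\<bar> i) i > 0"
      using n by (simp add: T_def)
    then obtain f where f: "f \<in> T i" "Polynomial.coeff f i > 0"
      and min: "\<And>h. h \<in> T i \<Longrightarrow> Polynomial.coeff h i > 0 \<Longrightarrow>
          nat (Polynomial.coeff f i) \<le> nat (Polynomial.coeff h i)"
      using ex_has_least_nat[of "\<lambda>f. f \<in> T i \<and> Polynomial.coeff f i > 0" _ "\<lambda>f. nat (Polynomial.coeff f i)"]
      by metis
    have "Polynomial.coeff f i dvd Polynomial.coeff h i" if h: "h \<in> T i" for h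
    proof (rule ccontr)
      assume nd: "\<not> Polynomial.coeff f i dvd Polynomial.coeff h i"
      let ?q = "Polynomial.coeff h i div Polynomial.coeff f i"
      let ?h = "h - Polynomial.smult ?q f"
      have "?h \<in> T i" using h f poly_ideal_diff[OF I _ poly_ideal_smult[OF I, of f], of h] by (simp add: T_def)
      moreover have e: "Polynomial.coeff ?h i = Polynomial.coeff h i mod Polynomial.coeff f i"
        by (simp add: minus_div_mult_eq_mod)
      moreover have "Polynomial.coeff h i mod Polynomial.coeff f i > 0"
        using nd f(2) by (metis dvd_eq_mod_eq_0 order_le_less pos_mod_sign)
      ultimately have "nat (Polynomial.coeff f i) \<le> nat (Polynomial.coeff h i mod Polynomial.coeff f i)"
        using min[of ?h] by simp
      then show False using f(2) pos_mod_bound[OF f(2), of "Polynomial.coeff h i"] by linarith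
    qed
    then show ?thesis using f by blast
  qed
  then have "\<forall>i. \<exists>f. f \<in> T i \<and> Polynomial.coeff f i > 0 \<and>
      (\<forall>h. h \<in> T i \<longrightarrow> Polynomial.coeff f i dvd Polynomial.coeff h i)" by blast
  from choice[OF this] show ?thesis by (simp add: T_def Ball_def imp_conjL)
qed

text \<open>A nonzero element \<open>e\<close> of least degree in \<open>I\<close> divides a nonzero
  integer multiple of each element of \<open>I\<close>. A root of \<open>e\<close> would thus be
  common to \<open>R\<close> and \<open>B\<close>, so \<open>e\<close> is constant by the
  fundamental theorem of algebra.\<close>

lemma const_in_ideal:
  assumes I: "poly_ideal I" and R: "R \<in> I" "R \<noteq> 0" and B: "B \<in> I"
    and nz: "\<And>z. ev R z = 0 \<Longrightarrow> ev B z \<noteq> 0"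
  obtains n where "[:n:] \<in> I" "n \<noteq> 0"
proof -
  obtain e where e: "e \<in> I" "e \<noteq> 0"
    and min: "\<And>g. g \<in> I \<Longrightarrow> g \<noteq> 0 \<Longrightarrow> Polynomial.degree e \<le> Polynomial.degree g"
    using ex_has_least_nat[of "\<lambda>f. f \<in> I \<and> f \<noteq> 0" R Polynomial.degree] R by blast
  have zero: "ev h z = 0" if h: "h \<in> I" and z: "ev e z = 0" for h z
  proof -
    obtain q r where qr: "pseudo_divmod h e = (q, r)" by force
    let ?c = "Polynomial.coeff e (Polynomial.degree e) ^ (Suc (Polynomial.degree h) - Polynomial.degree e)"
    from pseudo_divmod[OF e(2) qr] 
    have eq: "Polynomial.smult ?c h = e * q + r" and d: "r = 0 \<or> Polynomial.degree r < Polynomial.degree e" by auto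
    have "r = Polynomial.smult ?c h - q * e" using eq by (simp add: mult.commute)
    moreover have "q * e \<in> I" using I e(1) by (simp add: poly_ideal_def)
    ultimately have "r \<in> I" using poly_ideal_diff[OF I poly_ideal_smult[OF I h]] by metis
    then have "r = 0" using d min[of r] by linarith
    then have "of_int ?c * ev h z = 0"
      using arg_cong[OF eq, of "\<lambda>p. ev p z"] z by simp
    moreover have "?c \<noteq> 0" using e(2) by simp
    ultimately show ?thesis by (metis mult_eq_0_iff of_int_eq_0_iff)
  qed
  have "Polynomial.degree e = 0"
  proof (rule ccontr)
    assume "Polynomial.degree e \<noteq> 0"
    then have "\<not> constant (poly (map_poly of_int e :: complex poly))"
      by (simp add: constant_degree of_int_poly_degree)
    then obtain z where "ev e z = 0" using fundamental_theorem_of_algebra by blast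
    then show False using zero R(1) B nz by blast
  qed
  then obtain n where "e = [:n:]" by (auto elim: degree_eq_zeroE)
  then show ?thesis using that[of n] e by auto
qed

section \<open>Vandermonde matrices and the comparison of determinants\<close>

lemma poly_eq_sum_lessThan:
  assumes "\<forall>j\<ge>m. Polynomial.coeff p j = 0"
  shows "poly p z = (\<Sum>l<m. Polynomial.coeff p l * (z :: 'a :: comm_ring_1) ^ l)"
proof -
  have "p = (\<Sum>l<m. Polynomial.monom (Polynomial.coeff p l) l)"
    using assms by (intro poly_eqI) (simp add: coeff_sum not_less)
  then have "poly p z = poly (\<Sum>l<m. Polynomial.monom (Polynomial.coeff p l) l) z" by simp
  then show ?thesis by (simp add: poly_sum poly_monom)
qed

text \<open>A nonzero kernel vector would be the coefficient vector of a nonzero polynomial of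
  degree below \<open>m\<close> with \<open>m\<close> distinct roots.\<close>

lemma vandermonde_det_nonzero:
  fixes x :: "nat \<Rightarrow> 'a :: field"
  assumes "inj_on x {..<m}"
  shows "det (mat m m (\<lambda>(k, l). x k ^ l)) \<noteq> 0"
proof
  assume "det (mat m m (\<lambda>(k, l). x k ^ l)) = 0"
  then obtain v where v: "v \<in> carrier_vec m" "v \<noteq> 0\<^sub>v m" and
    Vv: "mat m m (\<lambda>(k, l). x k ^ l) *\<^sub>v v = 0\<^sub>v m"
    using det_0_iff_vec_prod_zero[of "mat m m (\<lambda>(k, l). x k ^ l)" m] by auto
  define p where "p = (\<Sum>l<m. Polynomial.monom (v $ l) l)"
  have coeff: "Polynomial.coeff p l = (if l < m then v $ l else 0)" for l
    by (simp add: p_def coeff_sum)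
  have p0: "p \<noteq> 0"
  proof
    assume "p = 0"
    then have "v $ l = 0" if "l < m" for l using coeff[of l] that by simp
    then have "v = 0\<^sub>v m" using v(1) by (intro eq_vecI) auto
    then show False using v(2) by simp
  qed
  have deg: "Polynomial.degree p < m"
  proof (rule ccontr)
    assume "\<not> ?thesis"
    then have "lead_coeff p = 0" by (simp only: coeff) simp
    then show False using p0 by simp
  qed
  have root: "poly p (x k) = 0" if k: "k < m" for k
  proof -
    have "poly p (x k) = (\<Sum>l<m. v $ l * x k ^ l)" by (simp add: p_def poly_sum poly_monom)
    also have "\<dots> = (mat m m (\<lambda>(k, l). x k ^ l) *\<^sub>v v) $ k"
      using k v(1) by (simp add: scalar_prod_def atLeast0LessThan mult.commute)
    finally show ?thesis unfolding Vv using k by simp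
  qed
  have "m = card (x ` {..<m})" using card_image[OF assms] by simp
  also have "\<dots> \<le> card {z. poly p z = 0}"
    using root by (intro card_mono poly_roots_finite p0) auto
  also have "\<dots> \<le> Polynomial.degree p" by (rule card_poly_roots_bound[OF p0])
  also note deg
  finally show False by simp
qed

text \<open>
  Comparing determinants in \<open>diag(b) V = V W U\<close>, where \<open>V\<close> is the Vandermonde matrix of \<open>x\<close>, \<open>W\<close> the
  triangular coefficient matrix of \<open>g\<close> and \<open>U\<close> the integer matrix \<open>u\<close>.
\<close>

lemma prod_leading_coeff_le_prod_norm:
  fixes g :: "nat \<Rightarrow> int poly" and b :: "nat \<Rightarrow> complex" and u :: "nat \<Rightarrow> nat \<Rightarrow> int"
  assumes x: "inj_on x {..<m}"
    and b: "\<And>k. k < m \<Longrightarrow> b k \<noteq> 0"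
    and g: "\<And>i j. i < m \<Longrightarrow> j > i \<Longrightarrow> Polynomial.coeff (g i) j = 0"
    and e: "\<And>k j. k < m \<Longrightarrow> j < m \<Longrightarrow> b k * x k ^ j = (\<Sum>i<m. of_int (u i j) * ev (g i) (x k))"
  shows "(\<Prod>i<m. \<bar>real_of_int (Polynomial.coeff (g i) i)\<bar>) \<le> (\<Prod>k<m. norm (b k))"
proof -
  define V where "V = mat m m (\<lambda>(k, l). x k ^ l)"
  define D where "D = mat m m (\<lambda>(k, l). if k = l then b k else 0)"
  define W where "W = mat m m (\<lambda>(l, i). complex_of_int (Polynomial.coeff (g i) l))"
  define U where "U = mat m m (\<lambda>(i, j). u i j)"
  define U' where "U' = (map_mat of_int U :: complex mat)"
  note defs = V_def D_def W_def U'_def U_def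
  have carr: "V \<in> carrier_mat m m" "D \<in> carrier_mat m m" "W \<in> carrier_mat m m"
    "U \<in> carrier_mat m m" "U' \<in> carrier_mat m m" by (simp_all add: defs)
  define G where "G = V * W"
  have G: "G \<in> carrier_mat m m" using carr by (simp add: G_def)
  have VW: "G $$ (k, i) = ev (g i) (x k)" if "k < m" "i < m" for k i
  proof -
    have "ev (g i) (x k) = (\<Sum>l<m. of_int (Polynomial.coeff (g i) l) * x k ^ l)"
      using g[OF that(2)] that by (subst poly_eq_sum_lessThan[of m]) (simp_all add: coeff_map_poly)
    then show ?thesis using that
      by (simp add: G_def V_def W_def scalar_prod_def atLeast0LessThan mult.commute)
  qed
  have "D * V = G * U'"
  proof (rule eq_matI)
    fix k j assume "k < dim_row (G * U')" "j < dim_col (G * U')"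
    then have kj: "k < m" "j < m" using carr G by auto
    have "(D * V) $$ (k, j) = (\<Sum>l<m. (if k = l then b k else 0) * x l ^ j)"
      using kj by (simp add: D_def V_def scalar_prod_def atLeast0LessThan)
    also have "\<dots> = (\<Sum>l<m. if k = l then b k * x l ^ j else 0)"
      by (intro sum.cong) auto
    also have "\<dots> = b k * x k ^ j" using kj by simp
    also have "\<dots> = (\<Sum>i<m. of_int (u i j) * ev (g i) (x k))" by (rule e[OF kj])
    also have "\<dots> = (\<Sum>i<m. G $$ (k, i) * U' $$ (i, j))"
      using kj by (intro sum.cong) (auto simp: VW U'_def U_def mult.commute)
    also have "\<dots> = (G * U') $$ (k, j)"
      using kj carr G by (simp add: scalar_prod_def atLeast0LessThan)
    finally show "(D * V) $$ (k, j) = (G * U') $$ (k, j)" .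
  qed (use carr G in auto)
  then have "det D * det V = det V * det W * det U'"
    using det_mult[OF carr(2,1)] det_mult[OF G carr(5)] det_mult[OF carr(1,3)] by (simp add: G_def)
  then have eq: "det D = det W * det U'"
    using vandermonde_det_nonzero[OF x] unfolding V_def by simp
  have diag: "prod_list (diag_mat (mat m m (\<lambda>(i, j). f i j))) = (\<Prod>i<m. f i i)" for f :: "nat \<Rightarrow> nat \<Rightarrow> complex"
    by (simp add: diag_mat_def prod.list_conv_set_nth atLeast0LessThan)
  have "det D = (\<Prod>k<m. b k)"
    by (subst det_upper_triangular[OF _ carr(2)]) (simp_all add: D_def diag upper_triangular_def)
  moreover have "det W = (\<Prod>i<m. of_int (Polynomial.coeff (g i) i))"
    by (subst det_upper_triangular[OF _ carr(3)]) (simp_all add: W_def diag g upper_triangular_def)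
  moreover have "det U' = of_int (det U)" unfolding U'_def by (rule of_int_hom.hom_det)
  ultimately have eq': "(\<Prod>k<m. b k) = (\<Prod>i<m. of_int (Polynomial.coeff (g i) i)) * of_int (det U)"
    using eq by simp
  moreover have "(\<Prod>k<m. b k) \<noteq> 0" using b by simp
  \<comment> \<open>As no \<open>b k\<close> vanishes, the integer \<open>det U\<close> is nonzero,
    hence at least 1 in absolute value; dropping it gives the inequality.\<close>
  ultimately have "det U \<noteq> 0" by auto
  then have "1 \<le> \<bar>real_of_int (det U)\<bar>" by linarith
  moreover have "(\<Prod>k<m. norm (b k)) =
      (\<Prod>i<m. \<bar>real_of_int (Polynomial.coeff (g i) i)\<bar>) * \<bar>real_of_int (det U)\<bar>"
    using arg_cong[OF eq', of norm] by (simp add: norm_mult prod_norm[symmetric])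
  ultimately show ?thesis
    using mult_left_mono[of 1 "\<bar>real_of_int (det U)\<bar>" "\<Prod>i<m. \<bar>real_of_int (Polynomial.coeff (g i) i)\<bar>"]
    by (simp add: prod_nonneg)
qed

section \<open>Counting representatives modulo an ideal containing \<open>R\<close> and
  \<open>B\<close>\<close>

text \<open>The elements of \<open>I\<close> of degree below \<open>m\<close> form a lattice whose
  index is the product of the diagonal entries \<open>a i\<close>. It contains the remainders of
  \<open>B T^j\<close> modulo \<open>R\<close>, whose determinant is up to sign the resultant, the
  product of the values \<open>B(z)\<close>.\<close>

lemma quotient_representatives:
  fixes R B :: "int poly" and Z :: "complex set"
  assumes Z: "finite Z" and R: "map_poly of_int R = (\<Prod>z\<in>Z. [:- z, 1:])"
    and B: "\<And>z. z \<in> Z \<Longrightarrow> ev B z \<noteq> 0"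
    and I: "poly_ideal I" "R \<in> I" "B \<in> I"
  obtains X where "finite X" "real (card X) \<le> (\<Prod>z\<in>Z. norm (ev B z))" "\<And>p. \<exists>x\<in>X. p - x \<in> I"
proof -
  define m where "m = card Z"
  have evR: "ev R w = (\<Prod>z\<in>Z. w - z)" for w unfolding R by (simp add: poly_prod)
  have "lead_coeff (map_poly of_int R :: complex poly) = 1"
    unfolding R by (simp add: lead_coeff_prod)
  then have lcR: "lead_coeff R = 1" by (simp add: of_int_poly_degree coeff_map_poly)
  have degR: "Polynomial.degree R = m"
  proof -
    have "Polynomial.degree (map_poly of_int R :: complex poly) = m"
      unfolding R m_def by (subst degree_prod_eq_sum_degree) auto
    then show ?thesis by (simp add: of_int_poly_degree)
  qed
  have R0: "R \<noteq> 0" using lcR by (metis leading_coeff_0_iff zero_neq_one)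
  have "ev R z = 0 \<Longrightarrow> ev B z \<noteq> 0" for z using B Z by (auto simp: evR)
  then obtain n where n: "[:n:] \<in> I" "n \<noteq> 0" using const_in_ideal[OF I(1,2) R0 I(3)] by blast
  obtain g where basis: "\<forall>i. g i \<in> I \<and> (\<forall>j>i. Polynomial.coeff (g i) j = 0) \<and> Polynomial.coeff (g i) i > 0 \<and>
      (\<forall>h\<in>I. (\<forall>j>i. Polynomial.coeff h j = 0) \<longrightarrow> Polynomial.coeff (g i) i dvd Polynomial.coeff h i)"
    using triangular_basis_exists[OF I(1) n] by (elim exE)
  have g: "\<And>i. g i \<in> I" "\<And>i j. j > i \<Longrightarrow> Polynomial.coeff (g i) j = 0" "\<And>i. Polynomial.coeff (g i) i > 0"
    and gdvd: "\<And>i h. h \<in> I \<Longrightarrow> \<forall>j>i. Polynomial.coeff h j = 0 \<Longrightarrow>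
      Polynomial.coeff (g i) i dvd Polynomial.coeff h i"
    using basis by simp_all
  define a where "a i = Polynomial.coeff (g i) i" for i
  have mod_R: "\<exists>q r. p = R * q + r \<and> (\<forall>j\<ge>m. Polynomial.coeff r j = 0)" for p
  proof -
    obtain q r where "p = R * q + r" "r = 0 \<or> Polynomial.degree r < Polynomial.degree R"
      using monic_division[OF lcR] .
    moreover from this(2) have "\<forall>j\<ge>m. Polynomial.coeff r j = 0"
      unfolding degR by (auto intro: coeff_eq_0)
    ultimately show ?thesis by blast
  qed
  have RI: "R * q \<in> I" for q using I by (simp add: poly_ideal_def mult.commute[of R])
  \<comment> \<open>Division by \<open>R\<close> and then reduction by the triangular basis bring
    every polynomial into this box.\<close>
  define X where "X = {x. (\<forall>j<m. 0 \<le> Polynomial.coeff x j \<and> Polynomial.coeff x j < a j)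
    \<and> (\<forall>j\<ge>m. Polynomial.coeff x j = 0)}"
  let ?F = "PiE {..<m} (\<lambda>j. {0..<a j})"
  have inj: "inj_on (\<lambda>x. restrict (Polynomial.coeff x) {..<m}) X"
  proof (rule inj_onI, rule poly_eqI)
    fix x y j assume xy: "x \<in> X" "y \<in> X"
      and eq: "restrict (Polynomial.coeff x) {..<m} = restrict (Polynomial.coeff y) {..<m}"
    show "Polynomial.coeff x j = Polynomial.coeff y j"
      using xy fun_cong[OF eq, of j] by (cases "j < m") (auto simp: X_def)
  qed
  have sub: "(\<lambda>x. restrict (Polynomial.coeff x) {..<m}) ` X \<subseteq> ?F"
    by (intro image_subsetI PiE_I) (simp_all add: X_def)
  have finF: "finite ?F" by (intro finite_PiE) auto
  have finX: "finite X" using finite_subset[OF sub finF] inj by (rule finite_imageD)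
  have "card X \<le> card ?F" using card_inj_on_le[OF inj sub finF] .
  also have "card ?F = (\<Prod>i<m. nat (a i))" by (simp add: card_PiE)
  finally have "real (card X) \<le> real (\<Prod>i<m. nat (a i))" by (rule of_nat_mono)
  also have "\<dots> = (\<Prod>i<m. \<bar>real_of_int (a i)\<bar>)"
    unfolding of_nat_prod using g(3) by (intro prod.cong refl) (simp add: a_def less_imp_le)
  also have "\<dots> \<le> (\<Prod>z\<in>Z. norm (ev B z))"
  proof -
    obtain x where x: "bij_betw x {..<m} Z"
      using ex_bij_betw_nat_finite[OF Z] unfolding m_def atLeast0LessThan by blast
    have xZ: "x k \<in> Z" if "k < m" for k using x that by (auto simp: bij_betw_def)
    have "\<exists>c. \<forall>k<m. ev B (x k) * x k ^ j = (\<Sum>i<m. of_int (c i) * ev (g i) (x k))" for j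
    proof -
      \<comment> \<open>\<open>B T^j\<close> and its remainder \<open>r\<close> agree at the roots
        of \<open>R\<close>, while \<open>r\<close> lies in \<open>I\<close> and has degree below
        \<open>m\<close>, hence is an integer combination of the first \<open>m\<close> basis
        elements.\<close>
      obtain q r where qr: "B * Polynomial.monom 1 j = R * q + r" "\<forall>j\<ge>m. Polynomial.coeff r j = 0"
        using mod_R by blast
      have "B * Polynomial.monom 1 j \<in> I"
        using I by (simp add: poly_ideal_def mult.commute[of B])
      from poly_ideal_diff[OF I(1) this RI[of q]] have "r \<in> I" unfolding qr(1) by simp
      have "\<exists>c. r = (\<Sum>i<m. Polynomial.smult (c i) (g i))"
      proof (rule expand_in_basis[where g = g and a = "\<lambda>i. Polynomial.coeff (g i) i", OF I(1) _ _ \<open>r \<in> I\<close> qr(2) order_refl])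
        show "Polynomial.coeff (g i) i dvd Polynomial.coeff h i"
          if "i < m" "h \<in> I" "\<forall>j>i. Polynomial.coeff h j = 0" for i h
          using gdvd that(2,3) .
      qed (simp add: g)
      then obtain c where c: "r = (\<Sum>i<m. Polynomial.smult (c i) (g i))" by (elim exE)
      have sum: "ev (\<Sum>i<m. Polynomial.smult (c i) (g i)) w = (\<Sum>i<m. of_int (c i) * ev (g i) w)" for w
        by (induction m) simp_all
      have "ev B (x k) * x k ^ j = (\<Sum>i<m. of_int (c i) * ev (g i) (x k))" if "k < m" for k
      proof -
        have "ev R (x k) = 0" using xZ[OF that] Z by (auto simp: evR)
        then have "ev B (x k) * x k ^ j = ev r (x k)" using arg_cong[OF qr(1), of "\<lambda>p. ev p (x k)"] by simp
        then show ?thesis unfolding c sum .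
      qed
      then show ?thesis by blast
    qed
    then have "\<forall>j. \<exists>c. \<forall>k<m. ev B (x k) * x k ^ j = (\<Sum>i<m. of_int (c i) * ev (g i) (x k))"
      by (rule allI)
    from choice[OF this] obtain u
      where u: "\<forall>j. \<forall>k<m. ev B (x k) * x k ^ j = (\<Sum>i<m. of_int (u j i) * ev (g i) (x k))"
      by (elim exE)
    have "(\<Prod>i<m. \<bar>real_of_int (a i)\<bar>) \<le> (\<Prod>k<m. norm (ev B (x k)))"
      unfolding a_def
    \<comment> \<open>The arguments of \<open>u\<close> are swapped: the coefficients of the
      \<open>j\<close>-th remainder form a column of the integer matrix.\<close>
    proof (rule prod_leading_coeff_le_prod_norm[where x = x and u = "\<lambda>i j. u j i"])
      show "inj_on x {..<m}" using x by (simp add: bij_betw_def)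
      show "ev B (x k) \<noteq> 0" if "k < m" for k using B[OF xZ[OF that]] .
      show "Polynomial.coeff (g i) j = 0" if "i < m" "j > i" for i j using g(2)[OF that(2)] .
      show "ev B (x k) * x k ^ j = (\<Sum>i<m. of_int (u j i) * ev (g i) (x k))" if "k < m" "j < m" for k j
        using u that(1) by (elim allE impE) assumption+
    qed
    also have "\<dots> = (\<Prod>z\<in>Z. norm (ev B z))" by (rule prod.reindex_bij_betw[OF x])
    finally show ?thesis .
  qed
  finally have "real (card X) \<le> (\<Prod>z\<in>Z. norm (ev B z))" .
  moreover have "\<exists>x\<in>X. p - x \<in> I" for p
  proof -
    obtain q r where qr: "p = R * q + r" "\<forall>j\<ge>m. Polynomial.coeff r j = 0" using mod_R by blast
    have "\<exists>x. r - x \<in> I \<and> (\<forall>j<m. 0 \<le> Polynomial.coeff x j \<and> Polynomial.coeff x j < a j)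
        \<and> (\<forall>j\<ge>m. Polynomial.coeff x j = 0)"
      by (rule reduce_to_box[where g = g and a = a, OF I(1) _ qr(2) order_refl]) (simp add: g a_def)
    then obtain x where x: "r - x \<in> I" "x \<in> X" unfolding X_def by blast
    have "p - x = R * q + (r - x)" using qr(1) by simp
    then have "p - x \<in> I" using poly_ideal_add[OF I(1) RI x(1)] by (simp only:)
    then show ?thesis using x(2) by blast
  qed
  ultimately show ?thesis by (rule that[OF finX])
qed

section \<open>Passage to the localisation\<close>

lemma localization_simps:
  "x \<in> carrier (int_poly_localization Q) \<longleftrightarrow> (\<exists>p k. x = to_fract p / to_fract Q ^ k)"
  "x \<otimes>\<^bsub>int_poly_localization Q\<^esub> y = x * y"
  "x \<oplus>\<^bsub>int_poly_localization Q\<^esub> y = x + y"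
  "\<one>\<^bsub>int_poly_localization Q\<^esub> = 1"
  "\<zero>\<^bsub>int_poly_localization Q\<^esub> = 0"
  by (auto simp: int_poly_localization_def)

lemma to_fract_in_localization: "to_fract p \<in> carrier (int_poly_localization Q)"
  unfolding localization_simps by (rule exI[of _ p], rule exI[of _ 0]) simp

lemma inverse_in_localization: "1 / to_fract Q ^ k \<in> carrier (int_poly_localization Q)"
  unfolding localization_simps by (rule exI[of _ 1], rule exI[of _ k]) simp

lemma to_fract_power: "to_fract (p ^ n) = to_fract p ^ n"
  by (induction n) simp_all

lemma localization_minus:
  assumes "Q \<noteq> 0" and x: "x \<in> carrier (int_poly_localization Q)" and y: "y \<in> carrier (int_poly_localization Q)"
  shows "x \<ominus>\<^bsub>int_poly_localization Q\<^esub> y = x - y"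
proof -
  interpret cring "int_poly_localization Q" by (rule cring_int_poly_localization[OF assms(1)])
  obtain p k where "y = to_fract p / to_fract Q ^ k" using y unfolding localization_simps by blast
  then have "- y = to_fract (- p) / to_fract Q ^ k" by simp
  then have "- y \<in> carrier (int_poly_localization Q)" unfolding localization_simps by blast
  then have "\<ominus>\<^bsub>int_poly_localization Q\<^esub> y = - y"
    using y by (intro minus_equality) (simp_all add: localization_simps(3,5))
  then show ?thesis by (simp add: a_minus_def localization_simps(3))
qed

text \<open>Two powers of \<open>Q\<close> share a representative in the finite set
  \<open>X\<close>, and \<open>Q\<close> is a unit, so some \<open>Q ^ b\<close> with
  \<open>b > 0\<close> is 1 modulo \<open>J\<close>. Denominators can therefore be traded for
  polynomials, and \<open>X\<close> represents all fractions.\<close>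

lemma card_localization_quotient_le:
  assumes Q: "Q \<noteq> 0" and J: "ideal J (int_poly_localization Q)"
    and X: "finite X" "\<And>p. \<exists>x\<in>X. to_fract (p - x) \<in> J"
  shows "finite (carrier (int_poly_localization Q Quot J))"
    and "card (carrier (int_poly_localization Q Quot J)) \<le> card X"
proof -
  let ?L = "int_poly_localization Q"
  interpret cring ?L by (rule cring_int_poly_localization[OF Q])
  interpret J: ideal J ?L by (rule J)
  have q: "to_fract Q \<noteq> 0" using Q by simp
  have add: "a + b \<in> J" if "a \<in> J" "b \<in> J" for a b
    using J.a_closed[OF that] by (simp add: localization_simps(3))
  have mul: "c * a \<in> J" if "c \<in> carrier ?L" "a \<in> J" for a c
    using J.I_l_closed[OF that(2,1)] by (simp add: localization_simps(2))
  have neg: "- a \<in> J" if "a \<in> J" for a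
    using mul[OF to_fract_in_localization[of "- 1"] that] by simp
  obtain f where f: "\<And>p. f p \<in> X" "\<And>p. to_fract (p - f p) \<in> J" using X(2) by metis
  have "\<not> inj (\<lambda>i::nat. f (Q ^ i))"
  proof
    assume "inj (\<lambda>i::nat. f (Q ^ i))"
    moreover have "range (\<lambda>i::nat. f (Q ^ i)) \<subseteq> X" using f(1) by blast
    ultimately show False using X(1) by (meson finite_imageD finite_subset infinite_UNIV_nat)
  qed
  then obtain i j :: nat where "i \<noteq> j" "f (Q ^ i) = f (Q ^ j)" unfolding inj_def by blast
  then obtain i j :: nat where ij: "i < j" "f (Q ^ i) = f (Q ^ j)"
    by (cases i j rule: linorder_cases) auto
  define b where "b = j - i"
  have b: "b > 0" "j = i + b" using ij(1) by (simp_all add: b_def)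
  have "to_fract (Q ^ j - f (Q ^ j)) + - to_fract (Q ^ i - f (Q ^ i)) \<in> J"
    by (intro add neg f)
  then have "to_fract Q ^ i * (to_fract Q ^ b - 1) \<in> J"
    unfolding ij(2) b(2) by (simp add: to_fract_power power_add algebra_simps)
  \<comment> \<open>The common factor \<open>Q ^ i\<close> is cancelled by its inverse in the
    localisation.\<close>
  from mul[OF inverse_in_localization this, of i]
  have Qb: "to_fract Q ^ b - 1 \<in> J" using q by simp
  have Qbk: "to_fract Q ^ (b * k) - 1 \<in> J" for k
  proof (induction k)
    case 0
    then show ?case using J.zero_closed by (simp add: localization_simps(5))
  next
    case (Suc k)
    have "to_fract (Q ^ b) * (to_fract Q ^ (b * k) - 1) + (to_fract Q ^ b - 1) \<in> J"
      by (intro add mul to_fract_in_localization Suc Qb)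
    then show ?case by (simp add: to_fract_power power_add algebra_simps)
  qed
  have rep: "\<exists>x\<in>X. y - to_fract x \<in> J" if y: "y \<in> carrier ?L" for y
  proof -
    obtain p k where pk: "y = to_fract p / to_fract Q ^ k" using y unfolding localization_simps by blast
    \<comment> \<open>Modulo \<open>J\<close>, \<open>y\<close> equals \<open>y Q^(bk)\<close>,
      which is the polynomial \<open>r\<close> below; \<open>b \<ge> 1\<close> makes the
      natural-number subtraction \<open>b * k - k\<close> a genuine one.\<close>
    have bk: "k \<le> b * k" using b(1) by simp
    define r where "r = p * Q ^ (b * k - k)"
    have "to_fract Q ^ (b * k) = to_fract Q ^ (b * k - k) * to_fract Q ^ k"
      using bk by (simp flip: power_add)
    then have e: "y * to_fract Q ^ (b * k) = to_fract r"
      using q by (simp add: pk r_def to_fract_power)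
    have "- (y * (to_fract Q ^ (b * k) - 1)) + to_fract (r - f r) \<in> J"
      by (intro add neg mul y Qbk f)
    also have "- (y * (to_fract Q ^ (b * k) - 1)) + to_fract (r - f r) = y - to_fract (f r)"
      unfolding right_diff_distrib e by simp
    finally show ?thesis using f(1) by blast
  qed
  have sub: "carrier (?L Quot J) \<subseteq> (\<lambda>x. J +>\<^bsub>?L\<^esub> to_fract x) ` X"
  proof
    fix C assume "C \<in> carrier (?L Quot J)"
    then obtain y where y: "y \<in> carrier ?L" "C = J +>\<^bsub>?L\<^esub> y"
      by (auto simp: FactRing_def A_RCOSETS_def')
    obtain x where x: "x \<in> X" "y - to_fract x \<in> J" using rep[OF y(1)] by blast
    have "y \<ominus>\<^bsub>?L\<^esub> to_fract x \<in> J"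
      using x(2) localization_minus[OF Q y(1) to_fract_in_localization] by simp
    then have "J +>\<^bsub>?L\<^esub> y = J +>\<^bsub>?L\<^esub> to_fract x"
      using quotient_eq_iff_same_a_r_cos[OF J y(1) to_fract_in_localization] by simp
    then show "C \<in> (\<lambda>x. J +>\<^bsub>?L\<^esub> to_fract x) ` X" using x(1) y(2) by simp
  qed
  then show "finite (carrier (?L Quot J))" using X(1) by (meson finite_imageI finite_subset)
  show "card (carrier (?L Quot J)) \<le> card X" using surj_card_le[OF X(1) sub] .
qed

text \<open>The contraction \<open>I\<close> of \<open>J\<close> to \<open>Z[T]\<close> contains
  \<open>B\<close>, and it contains \<open>R\<close> because \<open>R = A / Q\<close>.
  Representatives modulo \<open>I\<close> therefore also serve modulo \<open>J\<close>.\<close>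

lemma card_localization_quotient_le_prod:
  assumes Q: "Q \<noteq> 0" and A: "A = Q * R"
    and Z: "finite Z" and R: "map_poly of_int R = (\<Prod>z\<in>Z. [:- z, 1:])"
    and B: "\<And>z. z \<in> Z \<Longrightarrow> ev B z \<noteq> 0"
  defines "L \<equiv> int_poly_localization Q"
  defines "J \<equiv> Idl\<^bsub>L\<^esub> {to_fract A, to_fract B}"
  shows "finite (carrier (L Quot J))"
    and "real (card (carrier (L Quot J))) \<le> (\<Prod>z\<in>Z. norm (ev B z))"
proof -
  interpret cring L unfolding L_def by (rule cring_int_poly_localization[OF Q])
  have carr: "{to_fract A, to_fract B} \<subseteq> carrier L"
    by (simp add: L_def to_fract_in_localization)
  interpret J: ideal J L unfolding J_def by (rule genideal_ideal[OF carr])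
  have gen: "to_fract A \<in> J" "to_fract B \<in> J" using genideal_self[OF carr] by (simp_all add: J_def)
  have add: "a + b \<in> J" if "a \<in> J" "b \<in> J" for a b
    using J.a_closed[OF that] by (simp add: localization_simps(3) L_def)
  have mul: "c * a \<in> J" if "c \<in> carrier L" "a \<in> J" for a c
    using J.I_l_closed[OF that(2,1)] by (simp add: localization_simps(2) L_def)
  define I where "I = {p. to_fract p \<in> J}"
  have "poly_ideal I"
    using J.zero_closed add mul to_fract_in_localization
    by (auto simp: poly_ideal_def I_def localization_simps(5) L_def)
  moreover have "R \<in> I"
  proof -
    have "1 / to_fract Q ^ 1 * to_fract A \<in> J"
      using mul[OF _ gen(1)] inverse_in_localization unfolding L_def by blast
    then show ?thesis using Q by (simp add: A I_def)
  qed
  moreover have "B \<in> I" using gen(2) by (simp add: I_def)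
  ultimately obtain X where X: "finite X" "real (card X) \<le> (\<Prod>z\<in>Z. norm (ev B z))"
    "\<And>p. \<exists>x\<in>X. p - x \<in> I"
    using quotient_representatives[OF Z R B] by metis
  have rep: "\<exists>x\<in>X. to_fract (p - x) \<in> J" for p using X(3)[of p] by (simp add: I_def)
  note le = card_localization_quotient_le[OF Q J.ideal_axioms[unfolded L_def] X(1) rep]
  show "finite (carrier (L Quot J))" using le(1) by (simp add: L_def)
  show "real (card (carrier (L Quot J))) \<le> (\<Prod>z\<in>Z. norm (ev B z))"
    using of_nat_mono[OF le(2), where ?'a = real] X(2) unfolding L_def by linarith
qed

section \<open>Estimates on the unit circle and the final bound\<close>

lemma norm_ev_le_sum_coeff:
  assumes "norm z = 1"
  shows "norm (ev p z) \<le> (\<Sum>i\<le>Polynomial.degree p. \<bar>real_of_int (Polynomial.coeff p i)\<bar>)"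
  unfolding poly_altdef of_int_poly_degree
  by (rule order_trans[OF norm_sum]) (simp add: coeff_map_poly norm_mult norm_power assms)

theorem proposition4p1:
  fixes P :: "int poly" and \<zeta> :: "nat \<Rightarrow> complex"
  assumes "\<And>M :: nat. P \<noteq> [:0, 1:] ^ M \<and> P \<noteq> - ([:0, 1:] ^ M)"
    and "\<And>d. d \<ge> 1 \<Longrightarrow> primitive_root_of_unity d (\<zeta> d)"
  shows "\<exists>c :: real. c > 0 \<and>
    (\<forall>N :: nat. N \<ge> 1 \<longrightarrow>
      finite (carrier (quotient_ring P \<zeta> N)) \<and>
      ln (real (card (carrier (quotient_ring P \<zeta> N)))) \<le> c * (real N)\<^sup>2)"
proof -
  \<comment> \<open>The summand 1 ensures \<open>L \<ge> 1\<close>, even for \<open>P = 0\<close>,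
    so that \<open>ln L\<close> is nonnegative.\<close>
  define L where "L = 1 + (\<Sum>i\<le>Polynomial.degree P. \<bar>real_of_int (Polynomial.coeff P i)\<bar>)"
  have L1: "L \<ge> 1" unfolding L_def by (simp add: sum_nonneg)
  have L: "norm (ev P z) \<le> L" if "norm z = 1" for z
    using norm_ev_le_sum_coeff[OF that, of P] by (simp add: L_def)
  have "finite (carrier (quotient_ring P \<zeta> N)) \<and>
      ln (real (card (carrier (quotient_ring P \<zeta> N)))) \<le> (ln 2 + ln L) * (real N)\<^sup>2" if N: "N \<ge> 1" for N
  proof -
    let ?Pr = "\<lambda>d. {z. primitive_root_of_unity d z}"
    define D where "D = {d. d dvd N \<and> ev P (\<zeta> d) ^ N = 1}"
    define E where "E = {d. d dvd N \<and> ev P (\<zeta> d) ^ N \<noteq> 1}"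
    have fin: "finite D" "finite E" using N by (auto simp: D_def E_def)
    have Q: "Q_poly P \<zeta> N = (\<Prod>d\<in>D. cyclotomic d)" by (simp add: Q_poly_def D_def)
    \<comment> \<open>\<open>R\<close> collects the cyclotomic factors of \<open>T^N - 1\<close>
      that are not inverted; \<open>Z\<close> below is its set of roots.\<close>
    define R where "R = (\<Prod>d\<in>E. cyclotomic d)"
    define A where "A = ([:0, 1:] ^ N - 1 :: int poly)"
    define Z where "Z = (\<Union>d\<in>E. ?Pr d)"
    have "A = Polynomial.monom 1 N - 1" by (simp add: A_def monom_altdef)
    then have "map_poly of_int A = (Polynomial.monom 1 N - 1 :: complex poly)"
      by (simp add: of_int_poly_diff of_int_poly_monom of_int_poly_one)
    also have "\<dots> = (\<Prod>d | d dvd N. complex_cyclotomic d)" using prod_complex_cyclotomic[of N] N by simp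
    also have "{d. d dvd N} = D \<union> E" by (auto simp: D_def E_def)
    also have "(\<Prod>d\<in>\<dots>. complex_cyclotomic d) = (\<Prod>d\<in>D. complex_cyclotomic d) * (\<Prod>d\<in>E. complex_cyclotomic d)"
      using fin by (intro prod.union_disjoint) (auto simp: D_def E_def)
    also have "\<dots> = map_poly of_int (Q_poly P \<zeta> N * R)"
      using fin by (simp add: Q R_def of_int_poly_mult of_int_poly_prod of_int_cyclotomic)
    finally have A: "A = Q_poly P \<zeta> N * R" by (rule of_int_poly_inject)
    have finZ: "finite Z" using fin finite_primitive_roots by (auto simp: Z_def)
    have R: "map_poly of_int R = (\<Prod>z\<in>Z. [:- z, 1:])"
    proof -
      have "(\<Prod>z\<in>Z. [:- z, 1:]) = (\<Prod>d\<in>E. \<Prod>z\<in>?Pr d. [:- z, 1:])"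
        unfolding Z_def
      proof (rule prod.UNION_disjoint)
        show "\<forall>d\<in>E. \<forall>e\<in>E. d \<noteq> e \<longrightarrow> ?Pr d \<inter> ?Pr e = {}"
        proof (intro ballI impI equals0I)
          fix d e z assume "d \<noteq> e" "z \<in> ?Pr d \<inter> ?Pr e"
          moreover from this have "z ^ d = 1" "z ^ e = 1"
            by (simp_all add: primitive_root_of_unity_def)
          ultimately show False
            using primitive_root_dvd[of d z e] primitive_root_dvd[of e z d] dvd_antisym[of d e] by simp
        qed
      qed (use fin finite_primitive_roots in auto)
      then show ?thesis
        using fin by (simp add: R_def of_int_poly_prod of_int_cyclotomic complex_cyclotomic_def)
    qed
    have B: "ev (P ^ N - 1) z \<noteq> 0" if z: "z \<in> Z" for z
    proof
      assume z0: "ev (P ^ N - 1) z = 0"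
      obtain d where d: "d dvd N" "ev P (\<zeta> d) ^ N \<noteq> 1" "primitive_root_of_unity d z"
        using z by (auto simp: Z_def E_def)
      have "d \<ge> 1" using d(1) N by (cases d) auto
      then have "ev (P ^ N - 1) (\<zeta> d) = 0"
        using conjugate_roots_of_unity[OF d(3) assms(2) z0] by blast
      then show False using d(2) by simp
    qed
    have ZN: "Z \<subseteq> {z. z ^ N = 1}"
      unfolding roots_unity_partition[OF N[unfolded One_nat_def Suc_le_eq]] by (auto simp: Z_def E_def)
    have norm1: "norm z = 1" if "z \<in> Z" for z
    proof -
      have "norm z ^ N = 1" using ZN that by (auto simp flip: norm_power)
      then show ?thesis using N power_eq_imp_eq_base[of "norm z" N 1] by simp
    qed
    have bound: "norm (ev (P ^ N - 1) z) \<le> 2 * L ^ N" if "z \<in> Z" for z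
    proof -
      have "norm (ev (P ^ N - 1) z) \<le> norm (ev P z) ^ N + 1"
        using norm_triangle_ineq4[of "ev P z ^ N" 1] by (simp add: norm_power)
      also have "norm (ev P z) ^ N \<le> L ^ N" by (intro power_mono L norm1 that) simp
      also have "1 \<le> L ^ N" using L1 by (rule one_le_power)
      finally show ?thesis by simp
    qed
    have one: "1 \<le> 2 * L ^ N" using one_le_power[OF L1, of N] by simp
    have "card Z \<le> N"
      using card_mono[OF finite_roots_unity ZN] card_roots_unity_eq[of N] N by simp
    note main = card_localization_quotient_le_prod[OF Q_poly_nonzero A finZ R B]
    have e: "quotient_ring P \<zeta> N = int_poly_localization (Q_poly P \<zeta> N) Quot
        (Idl\<^bsub>int_poly_localization (Q_poly P \<zeta> N)\<^esub> {to_fract A, to_fract (P ^ N - 1)})"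
      by (simp only: quotient_ring_def Let_def A_def)
    let ?n = "card (carrier (quotient_ring P \<zeta> N))"
    have "real ?n \<le> (\<Prod>z\<in>Z. norm (ev (P ^ N - 1) z))" unfolding e by (rule main(2))
    also have "\<dots> \<le> (\<Prod>z\<in>Z. 2 * L ^ N)" using bound by (intro prod_mono) simp
    also have "\<dots> \<le> (2 * L ^ N) ^ N"
      using power_increasing[OF \<open>card Z \<le> N\<close> one] by simp
    finally have le: "real ?n \<le> (2 * L ^ N) ^ N" .
    have "ln (real ?n) \<le> (ln 2 + ln L) * (real N)\<^sup>2"
    \<comment> \<open>For \<open>?n = 0\<close> the logarithm has the default value
      \<open>ln 0 = 0\<close>, and the right-hand side is nonnegative.\<close>
    proof (cases "?n = 0")
      case True
      then show ?thesis using L1 by (simp add: add_nonneg_nonneg)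
    next
      case False
      then have "ln (real ?n) \<le> ln ((2 * L ^ N) ^ N)" using le one by (subst ln_le_cancel_iff) auto
      also have "\<dots> = real N * (ln 2 + real N * ln L)"
        using L1 by (simp add: ln_realpow ln_mult distrib_left)
      \<comment> \<open>Since \<open>N \<ge> 1\<close>, the term \<open>ln 2\<close> may be enlarged
        by a factor \<open>N\<close>, which makes both terms quadratic in \<open>N\<close>.\<close>
      also have "\<dots> \<le> real N * (real N * ln 2 + real N * ln L)"
        using N by (intro mult_left_mono add_right_mono) auto
      also have "\<dots> = (ln 2 + ln L) * (real N)\<^sup>2" by (simp add: power2_eq_square algebra_simps)
      finally show ?thesis .
    qed
    then show ?thesis using main(1) unfolding e by blast
  qed
  moreover have "ln 2 + ln L > 0" using L1 by (simp add: add_pos_nonneg)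
  ultimately show ?thesis by blast
qed

end
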